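(* Let $X$ be a CAT(0) space and let $X_D$ be its curtain model. Every isometry of $X_D$ is a $(1,1)$-quasiisometry of $X$.
   Context: **Curtains.** Let $(X,d)$ be a CAT(0) space. A geodesic is an isometric embedding $\alpha:I\to X$ of an interval $I\subset\mathbb R$, and $\pi_\alpha:X\to\alpha$ is closest-point projection. For $r$ with $[r-\frac12,r+\frac12]$ in the interior of $I$, the curtain dual to $\alpha$ at $r$ is $h=h_{\alpha,r}=\pi_\alpha^{-1}(\alpha[r-\frac12,r+\frac12])$. Its halfspaces are $h^-=\pi_\alpha^{-1}\alpha(I\cap(-\infty,r-\frac12))$ and $h^+=\pi_\alpha^{-1}\alpha(I\cap(r+\frac12,\infty))$. The curtain $h$ separates $A,B\subset X$ if one of them is contained in $h^-$ and the other in $h^+$. A chain is a set of pairwise disjoint curtains $\{h_i\}$, indexed by consecutive integers, such that $h_i$ separates $h_{i-1}$ from $h_{i+1}$ for all $i$; it separates $A$ from $B$ if every $h_i$ does. **$L$-separation and $d_L$.** For $L\in\mathbb N=\{0,1,2,\dots\}$, disjoint curtains $h,h'$ are $L$-separated if every chain all of whose elements meet both $h$ and $h'$ has cardinality at most $L$. An $L$-chain is a chain whose elements are pairwise $L$-separated. Set $d_L(x,x)=0$ and, for $x\neq y$, $d_L(x,y)=1+\max\{|c| : c \text{ is an } L\text{-chain separating } x \text{ from } y\}$. **Curtain model.** Fix numbers $\lambda_L\in(0,1)$, $L\ge1$, with $\sum\lambda_L<\sum L\lambda_L<\sum L^2\lambda_L=\Lambda<\infty$. Put $D(x,y)=\sum_{L=1}^\infty\lambda_L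 d_L(x,y)$. The curtain model is $X_D=(X,D)$, with the same underlying set as $X$; thus an isometry of $X_D$ is a bijection of $X$. A $(1,1)$-quasiisometry of $(X,d)$ is a coarsely surjective map $g:X\to X$ with $|d(gx,gy)-d(x,y)|\le1$ for all $x,y\in X$. *)

theory Defs
  imports "HOL-Analysis.Analysis"
begin

definition geodesic :: "real set \<Rightarrow> (real \<Rightarrow> 'a::metric_space) \<Rightarrow> bool" where
  "geodesic I \<alpha> \<longleftrightarrow> is_interval I \<and> (\<forall>s\<in>I. \<forall>t\<in>I. dist (\<alpha> s) (\<alpha> t) = \<bar>s - t\<bar>)"

definition geodesic_between :: "(real \<Rightarrow> 'a::metric_space) \<Rightarrow> 'a \<Rightarrow> 'a \<Rightarrow> bool" where
  "geodesic_between \<alpha> x y \<longleftrightarrow>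
     geodesic {0..dist x y} \<alpha> \<and> \<alpha> 0 = x \<and> \<alpha> (dist x y) = y"

text \<open>The comparison inequality is required for points on the two sides issuing from the first
  vertex of a geodesic triangle. As the vertices range over all orders, this covers every pair
  of distinct sides; for two points on the same side it holds with equality.\<close>

definition CAT0 :: "'a::metric_space itself \<Rightarrow> bool" where
  "CAT0 T \<longleftrightarrow>
     (\<forall>x y::'a. \<exists>\<alpha>. geodesic_between \<alpha> x y) \<and>
     (\<forall>(x::'a) y z \<alpha> \<beta> s t (x'::real^2) y' z' p' q'.
        geodesic_between \<alpha> x y \<and> geodesic_between \<beta> x z \<and>
        dist x' y' = dist x y \<and> dist y' z' = dist y z \<and> dist x' z' = dist x z \<and>
        s \<in> {0..dist x y} \<and> p' \<in> closed_segment x' y' \<and> dist x' p' = s \<and>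
        t \<in> {0..dist x z} \<and> q' \<in> closed_segment x' z' \<and> dist x' q' = t
        \<longrightarrow> dist (\<alpha> s) (\<beta> t) \<le> dist p' q')"

text \<open>The library's \<open>closest_point\<close> is restricted to Euclidean-like spaces.\<close>

definition nearest :: "'a::metric_space set \<Rightarrow> 'a \<Rightarrow> 'a \<Rightarrow> bool" where
  "nearest S x p \<longleftrightarrow> p \<in> S \<and> (\<forall>q\<in>S. dist x p \<le> dist x q)"

definition proj :: "'a::metric_space set \<Rightarrow> 'a \<Rightarrow> 'a" where
  "proj S x = (THE p. nearest S x p)"

text \<open>\<open>curtain_data I \<alpha> r\<close>: there is a curtain dual to \<open>\<alpha>\<close> at \<open>r\<close>. The last conjunct says
  that the closest-point projection to \<open>\<alpha>\<close> is defined on the whole space. In a CAT(0) space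
  it holds automatically when \<open>I\<close> is closed.\<close>

definition curtain_data :: "real set \<Rightarrow> (real \<Rightarrow> 'a::metric_space) \<Rightarrow> real \<Rightarrow> bool" where
  "curtain_data I \<alpha> r \<longleftrightarrow>
     geodesic I \<alpha> \<and> {r - 1/2..r + 1/2} \<subseteq> interior I \<and> (\<forall>x. \<exists>!p. nearest (\<alpha> ` I) x p)"

definition curtain :: "real set \<Rightarrow> (real \<Rightarrow> 'a::metric_space) \<Rightarrow> real \<Rightarrow> 'a set" where
  "curtain I \<alpha> r = proj (\<alpha> ` I) -` (\<alpha> ` {r - 1/2..r + 1/2})"

definition halfspace_minus :: "real set \<Rightarrow> (real \<Rightarrow> 'a::metric_space) \<Rightarrow> real \<Rightarrow> 'a set" where
  "halfspace_minus I \<alpha> r = proj (\<alpha> ` I) -` (\<alpha> ` (I \<inter> {..<r - 1/2}))"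

definition halfspace_plus :: "real set \<Rightarrow> (real \<Rightarrow> 'a::metric_space) \<Rightarrow> real \<Rightarrow> 'a set" where
  "halfspace_plus I \<alpha> r = proj (\<alpha> ` I) -` (\<alpha> ` (I \<inter> {r + 1/2<..}))"

definition is_curtain :: "'a::metric_space set \<Rightarrow> bool" where
  "is_curtain h \<longleftrightarrow> (\<exists>I \<alpha> r. curtain_data I \<alpha> r \<and> h = curtain I \<alpha> r)"

text \<open>Curtains are treated as sets. In a CAT(0) space the two halfspaces are the connected
  components of the complement of the curtain, so up to exchanging them they do not depend on
  the geodesic \<open>\<alpha>\<close> and the parameter \<open>r\<close> chosen to represent the curtain.\<close>

definition separates :: "'a::metric_space set \<Rightarrow> 'a set \<Rightarrow> 'a set \<Rightarrow> bool" where
  "separates h A B \<longleftrightarrow>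
     (\<exists>I \<alpha> r. curtain_data I \<alpha> r \<and> h = curtain I \<alpha> r \<and>
        (A \<subseteq> halfspace_minus I \<alpha> r \<and> B \<subseteq> halfspace_plus I \<alpha> r \<or>
         B \<subseteq> halfspace_minus I \<alpha> r \<and> A \<subseteq> halfspace_plus I \<alpha> r))"

text \<open>Curtains are nonempty, so the disjointness condition makes the indexing injective and
  \<open>card C\<close> is the number of indices. Empty and infinite chains are allowed.\<close>

definition is_chain :: "'a::metric_space set set \<Rightarrow> bool" where
  "is_chain C \<longleftrightarrow>
     (\<exists>(J::int set) h.
        (\<forall>i\<in>J. \<forall>k\<in>J. {i..k} \<subseteq> J) \<and>
        C = h ` J \<and>
        (\<forall>i\<in>J. is_curtain (h i)) \<and>
        (\<forall>i\<in>J. \<forall>j\<in>J. i \<noteq> j \<longrightarrow> h i \<inter> h j = {}) \<and>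
        (\<forall>i. i - 1 \<in> J \<and> i \<in> J \<and> i + 1 \<in> J \<longrightarrow> separates (h i) (h (i - 1)) (h (i + 1))))"

definition chain_separates :: "'a::metric_space set set \<Rightarrow> 'a set \<Rightarrow> 'a set \<Rightarrow> bool" where
  "chain_separates C A B \<longleftrightarrow> (\<forall>h\<in>C. separates h A B)"

definition L_separated :: "nat \<Rightarrow> 'a::metric_space set \<Rightarrow> 'a set \<Rightarrow> bool" where
  "L_separated L h h' \<longleftrightarrow>
     is_curtain h \<and> is_curtain h' \<and> h \<inter> h' = {} \<and>
     (\<forall>C. is_chain C \<and> (\<forall>k\<in>C. k \<inter> h \<noteq> {} \<and> k \<inter> h' \<noteq> {}) \<longrightarrow> finite C \<and> card C \<le> L)"

definition is_L_chain :: "nat \<Rightarrow> 'a::metric_space set set \<Rightarrow> bool" where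
  "is_L_chain L C \<longleftrightarrow> is_chain C \<and> pairwise (L_separated L) C"

text \<open>In a CAT(0) space every chain separating \<open>x\<close> from \<open>y\<close> is finite and has at most
  \<open>dist x y\<close> elements, and the empty chain always qualifies, so the maximum below is taken over
  a finite nonempty set.\<close>

definition d_L :: "nat \<Rightarrow> 'a::metric_space \<Rightarrow> 'a \<Rightarrow> nat" where
  "d_L L x y =
     (if x = y then 0
      else 1 + Max {card C |C. is_L_chain L C \<and> chain_separates C {x} {y}})"

text \<open>The weights have indices \<open>L \<ge> 1\<close>; the value at \<open>0\<close> is never used, and sums over
  \<open>L \<ge> 1\<close> are written as sums over all \<open>n\<close> with \<open>L = Suc n\<close>.\<close>

definition curtain_weights :: "(nat \<Rightarrow> real) \<Rightarrow> bool" where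
  "curtain_weights lam \<longleftrightarrow>
     (\<forall>L\<ge>1. 0 < lam L \<and> lam L < 1) \<and>
     summable (\<lambda>n. (real (Suc n))\<^sup>2 * lam (Suc n)) \<and>
     (\<Sum>n. lam (Suc n)) < (\<Sum>n. real (Suc n) * lam (Suc n)) \<and>
     (\<Sum>n. real (Suc n) * lam (Suc n)) < (\<Sum>n. (real (Suc n))\<^sup>2 * lam (Suc n))"

definition curtain_dist :: "(nat \<Rightarrow> real) \<Rightarrow> 'a::metric_space \<Rightarrow> 'a \<Rightarrow> real" where
  "curtain_dist lam x y = (\<Sum>n. lam (Suc n) * real (d_L (Suc n) x y))"

definition curtain_model_isometry :: "(nat \<Rightarrow> real) \<Rightarrow> ('a::metric_space \<Rightarrow> 'a) \<Rightarrow> bool" where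
  "curtain_model_isometry lam g \<longleftrightarrow>
     bij g \<and> (\<forall>x y. curtain_dist lam (g x) (g y) = curtain_dist lam x y)"

definition coarsely_surjective :: "('a::metric_space \<Rightarrow> 'a) \<Rightarrow> bool" where
  "coarsely_surjective g \<longleftrightarrow> (\<exists>K. \<forall>y. \<exists>x. dist (g x) y \<le> K)"

definition quasiisometry_1_1 :: "('a::metric_space \<Rightarrow> 'a) \<Rightarrow> bool" where
  "quasiisometry_1_1 g \<longleftrightarrow>
     coarsely_surjective g \<and> (\<forall>x y. \<bar>dist (g x) (g y) - dist x y\<bar> \<le> 1)"

end

theory Submission
  imports Defs
begin

text \<open>The metric \<open>D\<close> of the curtain model recognises which pairs of points are at distance at
  most \<open>1\<close> in the CAT(0) metric \<open>d\<close>. Closest-point projection to a geodesic is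
  \<open>1\<close>-Lipschitz (lemma \<open>CAT0_proj_nonexpansive\<close>), and the two halfspaces of a curtain project
  to parts of the geodesic that are more than \<open>1\<close> apart; hence no curtain separates points at
  distance at most \<open>1\<close>. Conversely, if \<open>d x y > 1\<close>, the curtain dual to a geodesic from \<open>x\<close>
  to \<open>y\<close> at its midpoint separates them. A single curtain is an \<open>L\<close>-chain for every \<open>L\<close>, so
  for \<open>x \<noteq> y\<close> all the numbers \<open>d_L L x y\<close> are equal to \<open>1\<close> in the first case, and all of them
  are at least \<open>2\<close> in the second. With \<open>\<lambda> = \<Sum>\<lambda>\<^sub>L\<close> this says that \<open>d x y \<le> 1\<close> if and only
  if \<open>D x y \<le> \<lambda>\<close> (lemma \<open>curtain_dist_le_iff\<close>).

  An isometry of the curtain model and its inverse therefore preserve the relation \<open>d \<le> 1\<close>.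
  In a geodesic space \<open>d x y \<le> n\<close> holds exactly if \<open>x\<close> and \<open>y\<close> are joined by \<open>n\<close> steps of
  length at most \<open>1\<close>, so the isometry preserves \<open>\<lceil>d x y\<rceil>\<close>, and it changes \<open>d\<close> by at most
  \<open>1\<close>.

  The Lipschitz property is proved through squared distances: the comparison inequality
  gives a Stewart inequality, which yields both the obtuse angle at a closest point and the
  inequality between the diagonals and the sides of a quadrilateral.\<close>

section \<open>Squared distances in CAT(0) spaces\<close>

lemma CAT0_ex_geodesic:
  fixes x y :: "'a::metric_space"
  assumes "CAT0 TYPE('a)"
  obtains \<gamma> where "geodesic_between \<gamma> x y"
  using assms unfolding CAT0_def by metis

lemma dist_vector_2:
  "dist (vector [a, b] :: real^2) (vector [c, d]) = sqrt ((a - c)\<^sup>2 + (b - d)\<^sup>2)"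
  by (simp add: dist_vec_def L2_set_def sum_2 dist_real_def)

text \<open>In the plane the inequality is an equality (Stewart's theorem). The comparison triangle has
  \<open>y\<close> at the origin and \<open>z\<close> on the first axis. The comparison inequality concerns points on
  two sides issuing from \<open>y\<close>; the vertex \<open>x\<close> enters as the far endpoint of the side from
  \<open>y\<close> to \<open>x\<close>.\<close>

lemma CAT0_Stewart:
  fixes x y z :: "'a::metric_space"
  assumes cat: "CAT0 TYPE('a)" and \<alpha>: "geodesic_between \<alpha> y z" and s: "s \<in> {0..dist y z}"
  shows "dist y z * (dist x (\<alpha> s))\<^sup>2
    \<le> (dist y z - s) * (dist x y)\<^sup>2 + s * (dist x z)\<^sup>2 - s * (dist y z - s) * dist y z"
proof (cases "dist y z = 0")
  case True
  then show ?thesis using s by simp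
next
  case False
  define D a b where "D = dist y z" and "a = dist x y" and "b = dist x z"
  have D: "D > 0" using False by (simp add: D_def less_le)
  define u where "u = (a\<^sup>2 + D\<^sup>2 - b\<^sup>2) / (2 * D)"
  define v where "v = sqrt (a\<^sup>2 - u\<^sup>2)"
  have tri: "b \<le> a + D" "a \<le> b + D" "D \<le> a + b" "0 \<le> a" "0 \<le> b"
    unfolding D_def a_def b_def by metric+
  \<comment> \<open>The triangle inequalities are what places the third comparison vertex in the real plane.\<close>
  have "u \<le> a"
  proof -
    have "(a - D)\<^sup>2 \<le> b\<^sup>2" using tri by (simp add: abs_le_square_iff [symmetric])
    then show ?thesis using D by (simp add: u_def divide_simps power2_diff algebra_simps)
  qed
  moreover have "- a \<le> u"
  proof -
    have "b\<^sup>2 \<le> (a + D)\<^sup>2" using tri by (intro power_mono) auto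
    then show ?thesis using D by (simp add: u_def field_simps power2_sum)
  qed
  ultimately have "u\<^sup>2 \<le> a\<^sup>2" using tri by (simp add: abs_le_square_iff [symmetric])
  then have v: "v\<^sup>2 = a\<^sup>2 - u\<^sup>2" by (simp add: v_def)
  have u: "2 * D * u = a\<^sup>2 + D\<^sup>2 - b\<^sup>2" using D by (simp add: u_def)
  define y' z' x' p' :: "real^2"
    where "y' = vector [0, 0]" and "z' = vector [D, 0]" and "x' = vector [u, v]"
      and "p' = vector [s, 0]"
  have yz: "dist y' z' = dist y z" using D by (simp add: y'_def z'_def dist_vector_2 D_def)
  have yx: "dist y' x' = dist y x"
    using v tri by (simp add: y'_def x'_def dist_vector_2 a_def dist_commute)
  have "(D - u)\<^sup>2 + v\<^sup>2 = b\<^sup>2" using u v by (simp add: power2_diff)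
  then have zx: "dist z' x' = dist z x"
    using tri by (simp add: z'_def x'_def dist_vector_2 b_def dist_commute)
  have s': "0 \<le> s" "s \<le> D" using s by (auto simp: D_def)
  have yp: "dist y' p' = s" using s' by (simp add: y'_def p'_def dist_vector_2)
  have "p' = (1 - s / D) *\<^sub>R y' + (s / D) *\<^sub>R z'"
    using D by (simp add: vec_eq_iff forall_2 y'_def z'_def p'_def)
  then have seg: "p' \<in> closed_segment y' z'"
    using D s' unfolding closed_segment_def by (intro CollectI exI [of _ "s / D"]) auto
  obtain \<beta> where \<beta>: "geodesic_between \<beta> y x" by (rule CAT0_ex_geodesic [OF cat])
  have "dist (\<alpha> s) (\<beta> (dist y x)) \<le> dist p' x'"
    using cat [unfolded CAT0_def, THEN conjunct2, rule_format,
        of \<alpha> y z \<beta> x y' z' x' s p' "dist y x" x']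
      \<alpha> \<beta> yz yx zx s seg yp by auto
  then have "dist x (\<alpha> s) \<le> dist p' x'" using \<beta> by (simp add: geodesic_between_def dist_commute)
  then have "(dist x (\<alpha> s))\<^sup>2 \<le> (dist p' x')\<^sup>2" by (intro power_mono) auto
  also have "\<dots> = (s - u)\<^sup>2 + v\<^sup>2" by (simp add: p'_def x'_def dist_vector_2)
  also have "\<dots> = a\<^sup>2 - 2 * u * s + s\<^sup>2" using v by (simp add: power2_diff)
  finally have "D * (dist x (\<alpha> s))\<^sup>2 \<le> D * (a\<^sup>2 - 2 * u * s + s\<^sup>2)" using D by simp
  also have "\<dots> = D * a\<^sup>2 - s * (2 * D * u) + D * s\<^sup>2" by (simp add: algebra_simps)
  also have "\<dots> = (D - s) * a\<^sup>2 + s * b\<^sup>2 - s * (D - s) * D"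
    unfolding u by (simp add: algebra_simps power2_eq_square)
  finally show ?thesis by (simp add: D_def a_def b_def)
qed

text \<open>Apply the Stewart inequality at the midpoint of one diagonal from both of the remaining
  vertices, and bound the other diagonal by the path through that midpoint.\<close>

lemma CAT0_quadrilateral:
  fixes w x y z :: "'a::metric_space"
  assumes cat: "CAT0 TYPE('a)"
  shows "(dist w y)\<^sup>2 + (dist x z)\<^sup>2
    \<le> (dist w x)\<^sup>2 + (dist x y)\<^sup>2 + (dist y z)\<^sup>2 + (dist z w)\<^sup>2"
proof (cases "x = z")
  case True
  have "(dist w y)\<^sup>2 \<le> (dist w x + dist x y)\<^sup>2" by (intro power_mono dist_triangle) auto
  also have "\<dots> \<le> 2 * (dist w x)\<^sup>2 + 2 * (dist x y)\<^sup>2"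
    using sum_squares_bound [of "dist w x" "dist x y"] by (simp add: power2_sum)
  finally show ?thesis using True by (simp add: dist_commute)
next
  case False
  define D where "D = dist x z"
  have D: "D > 0" using False by (simp add: D_def)
  obtain \<gamma> where \<gamma>: "geodesic_between \<gamma> x z" by (rule CAT0_ex_geodesic [OF cat])
  define m where "m = \<gamma> (D / 2)"
  have mid: "2 * (dist v m)\<^sup>2 \<le> (dist v x)\<^sup>2 + (dist v z)\<^sup>2 - D\<^sup>2 / 2" for v
  proof -
    have "D * (dist v m)\<^sup>2
      \<le> (D - D/2) * (dist v x)\<^sup>2 + D/2 * (dist v z)\<^sup>2 - D/2 * (D - D/2) * D"
      using CAT0_Stewart [OF cat \<gamma>, of "D/2" v] D by (simp add: D_def m_def)
    then have "D * (2 * (dist v m)\<^sup>2) \<le> D * ((dist v x)\<^sup>2 + (dist v z)\<^sup>2 - D\<^sup>2 / 2)"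
      by (simp add: field_simps power2_eq_square)
    then show ?thesis using D by simp
  qed
  have "(dist w y)\<^sup>2 \<le> (dist w m + dist y m)\<^sup>2" by (intro power_mono dist_triangle2) auto
  also have "\<dots> \<le> 2 * (dist w m)\<^sup>2 + 2 * (dist y m)\<^sup>2"
    using sum_squares_bound [of "dist w m" "dist y m"] by (simp add: power2_sum)
  finally show ?thesis using mid [of w] mid [of y] by (simp add: D_def dist_commute)
qed

section \<open>Projection to a geodesic\<close>

lemma geodesic_between_subgeodesic:
  assumes \<alpha>: "geodesic I \<alpha>" and st: "s \<in> I" "t \<in> I"
  obtains \<gamma> where "geodesic_between \<gamma> (\<alpha> s) (\<alpha> t)"
    and "\<And>\<tau>. \<tau> \<in> {0..dist (\<alpha> s) (\<alpha> t)} \<Longrightarrow> \<gamma> \<tau> \<in> \<alpha> ` I"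
proof
  let ?\<phi> = "\<lambda>\<tau>. s + sgn (t - s) * \<tau>"
  have d: "dist (\<alpha> s) (\<alpha> t) = \<bar>t - s\<bar>" using \<alpha> st by (auto simp: geodesic_def)
  have I: "?\<phi> \<tau> \<in> I" if "\<tau> \<in> {0..\<bar>t - s\<bar>}" for \<tau>
  proof -
    have "s \<le> ?\<phi> \<tau> \<and> ?\<phi> \<tau> \<le> t \<or> t \<le> ?\<phi> \<tau> \<and> ?\<phi> \<tau> \<le> s"
      using that by (auto simp: sgn_real_def abs_real_def split: if_splits)
    then show ?thesis using \<alpha> st unfolding geodesic_def is_interval_1 by blast
  qed
  then show "\<And>\<tau>. \<tau> \<in> {0..dist (\<alpha> s) (\<alpha> t)} \<Longrightarrow> (\<alpha> \<circ> ?\<phi>) \<tau> \<in> \<alpha> ` I"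
    by (auto simp: d)
  have "dist ((\<alpha> \<circ> ?\<phi>) a) ((\<alpha> \<circ> ?\<phi>) b) = \<bar>a - b\<bar>"
    if "a \<in> {0..\<bar>t - s\<bar>}" "b \<in> {0..\<bar>t - s\<bar>}" for a b
  proof -
    have "dist ((\<alpha> \<circ> ?\<phi>) a) ((\<alpha> \<circ> ?\<phi>) b) = \<bar>?\<phi> a - ?\<phi> b\<bar>"
      using \<alpha> I that unfolding geodesic_def o_def by blast
    also have "\<dots> = \<bar>a - b\<bar>"
      using that by (auto simp: sgn_real_def abs_real_def split: if_splits)
    finally show ?thesis .
  qed
  then show "geodesic_between (\<alpha> \<circ> ?\<phi>) (\<alpha> s) (\<alpha> t)"
    unfolding geodesic_between_def geodesic_def by (auto simp: d sgn_mult_abs)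
qed

text \<open>The angle at a closest point \<open>p\<close> is at least a right angle: otherwise moving from \<open>p\<close> a
  small distance \<open>s\<close> towards \<open>q\<close> would decrease the distance to \<open>x\<close>, by the Stewart
  inequality.\<close>

lemma CAT0_nearest_obtuse:
  fixes x :: "'a::metric_space"
  assumes cat: "CAT0 TYPE('a)" and \<alpha>: "geodesic I \<alpha>"
    and p: "nearest (\<alpha> ` I) x p" and q: "q \<in> \<alpha> ` I"
  shows "(dist x p)\<^sup>2 + (dist p q)\<^sup>2 \<le> (dist x q)\<^sup>2"
proof (cases "p = q")
  case True
  then show ?thesis by simp
next
  case False
  define D where "D = dist p q"
  have D: "D > 0" using False by (simp add: D_def)
  obtain \<gamma> where \<gamma>: "geodesic_between \<gamma> p q" and \<gamma>I: "\<And>\<tau>. \<tau> \<in> {0..D} \<Longrightarrow> \<gamma> \<tau> \<in> \<alpha> ` I"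
    using p q geodesic_between_subgeodesic [OF \<alpha>] unfolding nearest_def D_def by blast
  have "(dist x p)\<^sup>2 + D\<^sup>2 \<le> (dist x q)\<^sup>2 + e" if "e > 0" for e
  proof -
    \<comment> \<open>The step \<open>s\<close> stays on the segment and makes the error term \<open>s * D\<close> at most \<open>e\<close>.\<close>
    define s where "s = min D (e / D)"
    have s: "0 < s" "s \<le> D" using D that by (auto simp: s_def)
    have "s \<le> e / D" by (simp add: s_def)
    then have sD: "s * D \<le> e" using D by (simp add: field_simps)
    have "dist x p \<le> dist x (\<gamma> s)" using p \<gamma>I [of s] s by (auto simp: nearest_def)
    then have "D * (dist x p)\<^sup>2 \<le> D * (dist x (\<gamma> s))\<^sup>2"
      using D by (intro mult_left_mono power_mono) auto
    also have "\<dots> \<le> (D - s) * (dist x p)\<^sup>2 + s * (dist x q)\<^sup>2 - s * (D - s) * D"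
      using CAT0_Stewart [OF cat \<gamma>, of s x] s by (simp add: D_def)
    finally have "s * ((dist x p)\<^sup>2 + D\<^sup>2) \<le> s * ((dist x q)\<^sup>2 + s * D)"
      by (simp add: algebra_simps power2_eq_square)
    then show ?thesis using s sD by simp
  qed
  then show ?thesis unfolding D_def by (rule field_le_epsilon)
qed

text \<open>The obtuse angles at \<open>p\<close> and \<open>q\<close> bound the squared diagonals of the quadrilateral
  \<open>x, y, q, p\<close> from below by \<open>(x p)\<^sup>2 + (y q)\<^sup>2 + 2 (p q)\<^sup>2\<close>, while the quadrilateral
  inequality bounds them from above by the sum of the squared sides. What remains after
  cancelling is \<open>(p q)\<^sup>2 \<le> (x y)\<^sup>2\<close>.\<close>

lemma CAT0_proj_nonexpansive:
  fixes x y :: "'a::metric_space"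
  assumes cat: "CAT0 TYPE('a)" and \<alpha>: "geodesic I \<alpha>"
    and p: "nearest (\<alpha> ` I) x p" and q: "nearest (\<alpha> ` I) y q"
  shows "dist p q \<le> dist x y"
proof -
  have "(dist x p)\<^sup>2 + (dist p q)\<^sup>2 \<le> (dist x q)\<^sup>2"
    using CAT0_nearest_obtuse [OF cat \<alpha> p] q by (simp add: nearest_def)
  moreover have "(dist y q)\<^sup>2 + (dist q p)\<^sup>2 \<le> (dist y p)\<^sup>2"
    using CAT0_nearest_obtuse [OF cat \<alpha> q] p by (simp add: nearest_def)
  moreover have "(dist x q)\<^sup>2 + (dist y p)\<^sup>2
    \<le> (dist x y)\<^sup>2 + (dist y q)\<^sup>2 + (dist q p)\<^sup>2 + (dist p x)\<^sup>2"
    by (rule CAT0_quadrilateral [OF cat])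
  ultimately have "(dist p q)\<^sup>2 \<le> (dist x y)\<^sup>2"
    by (simp only: dist_commute [of q p] dist_commute [of p x])
  then show ?thesis by (rule power2_le_imp_le) simp
qed

lemma CAT0_unique_nearest:
  fixes x :: "'a::metric_space"
  assumes cat: "CAT0 TYPE('a)" and \<alpha>: "geodesic I \<alpha>" and I: "compact I" "I \<noteq> {}"
  shows "\<exists>!p. nearest (\<alpha> ` I) x p"
proof (rule ex_ex1I)
  have "continuous_on I \<alpha>"
    using \<alpha> unfolding geodesic_def continuous_on_iff dist_real_def by metis
  then have "compact (\<alpha> ` I)" using I by (intro compact_continuous_image)
  then show "\<exists>p. nearest (\<alpha> ` I) x p"
    using continuous_attains_inf [of "\<alpha> ` I" "dist x"] I
      continuous_on_dist [OF continuous_on_const continuous_on_id, of "\<alpha> ` I" x]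
    unfolding nearest_def by blast
next
  fix p q assume p: "nearest (\<alpha> ` I) x p" and q: "nearest (\<alpha> ` I) x q"
  then have "dist p q \<le> dist x x" by (rule CAT0_proj_nonexpansive [OF cat \<alpha>])
  then show "p = q" by simp
qed

lemma nearest_proj: "\<exists>!p. nearest S x p \<Longrightarrow> nearest S x (proj S x)"
  unfolding proj_def by (rule theI')

section \<open>Curtains separate exactly the points at distance more than one\<close>

lemma halfspaces_far_apart:
  fixes x y :: "'a::metric_space"
  assumes cat: "CAT0 TYPE('a)" and cd: "curtain_data I \<alpha> r"
    and x: "x \<in> halfspace_minus I \<alpha> r" and y: "y \<in> halfspace_plus I \<alpha> r"
  shows "dist x y > 1"
proof -
  have \<alpha>: "geodesic I \<alpha>" and ex: "\<And>x. \<exists>!p. nearest (\<alpha> ` I) x p"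
    using cd by (auto simp: curtain_data_def)
  obtain s where s: "s \<in> I" "s < r - 1/2" "proj (\<alpha> ` I) x = \<alpha> s"
    using x by (auto simp: halfspace_minus_def)
  obtain t where t: "t \<in> I" "t > r + 1/2" "proj (\<alpha> ` I) y = \<alpha> t"
    using y by (auto simp: halfspace_plus_def)
  have "1 < \<bar>s - t\<bar>" using s t by simp
  also have "\<dots> = dist (\<alpha> s) (\<alpha> t)" using \<alpha> s t by (simp add: geodesic_def)
  also have "\<dots> \<le> dist x y"
    using CAT0_proj_nonexpansive [OF cat \<alpha> nearest_proj nearest_proj, OF ex ex, of x y] s t by simp
  finally show ?thesis .
qed

lemma separates_points_imp_far:
  fixes x y :: "'a::metric_space"
  assumes "CAT0 TYPE('a)" "separates h {x} {y}"
  shows "dist x y > 1"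
proof -
  obtain I \<alpha> r where cd: "curtain_data I \<alpha> r"
    and "x \<in> halfspace_minus I \<alpha> r \<and> y \<in> halfspace_plus I \<alpha> r \<or>
      y \<in> halfspace_minus I \<alpha> r \<and> x \<in> halfspace_plus I \<alpha> r"
    using assms(2) by (auto simp: separates_def)
  then show ?thesis
    using halfspaces_far_apart [OF assms(1) cd, of x y] halfspaces_far_apart [OF assms(1) cd, of y x]
    by (auto simp: dist_commute)
qed

lemma curtain_halfspaces_cover:
  assumes "curtain_data I \<alpha> r"
  shows "x \<in> halfspace_minus I \<alpha> r \<or> x \<in> curtain I \<alpha> r \<or> x \<in> halfspace_plus I \<alpha> r"
proof -
  have "nearest (\<alpha> ` I) x (proj (\<alpha> ` I) x)"
    using assms by (intro nearest_proj) (simp add: curtain_data_def)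
  then obtain s where "s \<in> I" "proj (\<alpha> ` I) x = \<alpha> s" by (auto simp: nearest_def)
  then show ?thesis
    unfolding halfspace_minus_def curtain_def halfspace_plus_def
    by (cases "s < r - 1/2"; cases "s > r + 1/2") auto
qed

lemma CAT0_ex_separating_curtain:
  fixes x y :: "'a::metric_space"
  assumes cat: "CAT0 TYPE('a)" and xy: "dist x y > 1"
  shows "\<exists>h. separates h {x} {y}"
proof -
  let ?I = "{0..dist x y}" and ?r = "dist x y / 2"
  obtain \<alpha> where "geodesic_between \<alpha> x y" by (rule CAT0_ex_geodesic [OF cat])
  then have \<alpha>: "geodesic ?I \<alpha>" and ends: "\<alpha> 0 = x" "\<alpha> (dist x y) = y"
    by (auto simp: geodesic_between_def)
  have ex: "\<exists>!p. nearest (\<alpha> ` ?I) z p" for z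
    by (rule CAT0_unique_nearest [OF cat \<alpha>]) auto
  have "{?r - 1/2..?r + 1/2} \<subseteq> interior ?I" using xy by (auto simp: interior_atLeastAtMost_real)
  then have cd: "curtain_data ?I \<alpha> ?r" using \<alpha> ex by (simp add: curtain_data_def)
  have on: "proj (\<alpha> ` ?I) z = z" if "z \<in> \<alpha> ` ?I" for z
  proof -
    have "nearest (\<alpha> ` ?I) z z" using that by (simp add: nearest_def)
    then show ?thesis using nearest_proj [OF ex, of z] ex by blast
  qed
  have "x \<in> \<alpha> ` ?I" "y \<in> \<alpha> ` ?I" 
    using imageI [of 0 ?I \<alpha>] imageI [of "dist x y" ?I \<alpha>] by (simp_all add: ends)
  then have "proj (\<alpha> ` ?I) x = \<alpha> 0" "proj (\<alpha> ` ?I) y = \<alpha> (dist x y)"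
    by (simp_all add: on ends)
  moreover have "0 \<in> ?I \<inter> {..<?r - 1/2}" "dist x y \<in> ?I \<inter> {?r + 1/2<..}" using xy by auto
  ultimately have "{x} \<subseteq> halfspace_minus ?I \<alpha> ?r" "{y} \<subseteq> halfspace_plus ?I \<alpha> ?r"
    unfolding halfspace_minus_def halfspace_plus_def by blast+
  then show ?thesis using cd unfolding separates_def by blast
qed

section \<open>Unit steps along a geodesic\<close>

text \<open>These paths serve twice: they bound the number of disjoint curtains that separate \<open>x\<close>
  from \<open>y\<close>, and they turn a map that preserves \<open>d \<le> 1\<close> into one that controls all
  distances.\<close>

lemma geodesic_between_unit_steps:
  fixes x y :: "'a::metric_space"
  assumes \<gamma>: "geodesic_between \<gamma> x y" and n: "dist x y \<le> real n"
  obtains p :: "nat \<Rightarrow> 'a" where "p 0 = x" "p n = y" "\<And>i. dist (p i) (p (Suc i)) \<le> 1"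
proof
  let ?p = "\<lambda>i. \<gamma> (min (real i) (dist x y))"
  show "?p 0 = x" "?p n = y" using \<gamma> n by (auto simp: geodesic_between_def min_absorb2)
  show "dist (?p i) (?p (Suc i)) \<le> 1" for i
  proof -
    have "dist (?p i) (?p (Suc i)) = \<bar>min (real i) (dist x y) - min (real (Suc i)) (dist x y)\<bar>"
      using \<gamma> by (auto simp: geodesic_between_def geodesic_def)
    also have "\<dots> \<le> 1" by linarith
    finally show ?thesis .
  qed
qed

text \<open>A path with steps of length at most \<open>1\<close> cannot jump over a curtain, so it has to visit it.\<close>

lemma separating_curtain_meets_path:
  fixes p :: "nat \<Rightarrow> 'a::metric_space"
  assumes cat: "CAT0 TYPE('a)" and steps: "\<And>i. dist (p i) (p (Suc i)) \<le> 1"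
    and sep: "separates h {p 0} {p n}"
  shows "\<exists>i\<le>n. p i \<in> h"
proof -
  obtain I \<alpha> r where cd: "curtain_data I \<alpha> r" and h: "h = curtain I \<alpha> r"
    and cases: "p 0 \<in> halfspace_minus I \<alpha> r \<and> p n \<in> halfspace_plus I \<alpha> r \<or>
        p n \<in> halfspace_minus I \<alpha> r \<and> p 0 \<in> halfspace_plus I \<alpha> r"
    using sep by (auto simp: separates_def)
  let ?M = "halfspace_minus I \<alpha> r" and ?P = "halfspace_plus I \<alpha> r"
  have far: "dist u v > 1" if "u \<in> ?M" "v \<in> ?P" for u v
    using halfspaces_far_apart [OF cat cd] that by blast
  have step: "u \<in> ?M \<longleftrightarrow> v \<in> ?M" if "dist u v \<le> 1" "u \<notin> h" "v \<notin> h" for u v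
    using curtain_halfspaces_cover [OF cd, of u] curtain_halfspaces_cover [OF cd, of v]
      far [of u v] far [of v u] that by (auto simp: h dist_commute)
  show ?thesis
  proof (rule ccontr)
    assume "\<not> ?thesis"
    then have out: "p i \<notin> h" if "i \<le> n" for i using that by blast
    have "i \<le> n \<Longrightarrow> p i \<in> ?M \<longleftrightarrow> p 0 \<in> ?M" for i
    proof (induction i)
      case (Suc i)
      then show ?case using step [OF steps [of i]] out [of i] out [of "Suc i"] by simp
    qed simp
    then have "p 0 \<in> ?M \<longleftrightarrow> p n \<in> ?M" by blast
    then show False using cases far [of "p 0" "p 0"] far [of "p n" "p n"] by auto
  qed
qed

text \<open>Disjoint curtains are visited at different times.\<close>

lemma separating_chain_bounded:
  fixes p :: "nat \<Rightarrow> 'a::metric_space"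
  assumes cat: "CAT0 TYPE('a)" and steps: "\<And>i. dist (p i) (p (Suc i)) \<le> 1"
    and C: "is_chain C" "chain_separates C {p 0} {p n}"
  shows "card C \<le> Suc n"
proof -
  have "\<exists>i\<le>n. p i \<in> h" if "h \<in> C" for h
    using separating_curtain_meets_path [of p, OF cat steps] C that by (simp add: chain_separates_def)
  then obtain k where k: "\<And>h. h \<in> C \<Longrightarrow> k h \<le> n \<and> p (k h) \<in> h" by metis
  obtain J :: "int set" and f where J: "C = f ` J"
    and f: "\<forall>i\<in>J. \<forall>j\<in>J. i \<noteq> j \<longrightarrow> f i \<inter> f j = {}"
    using C(1) unfolding is_chain_def by (elim exE conjE) (rule that)
  have disj: "h \<inter> h' = {}" if hh: "h \<in> C" "h' \<in> C" "h \<noteq> h'" for h h'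
  proof -
    obtain i j where "i \<in> J" "j \<in> J" and ij: "h = f i" "h' = f j" using hh J by blast
    moreover have "i \<noteq> j" using ij hh(3) by blast
    ultimately show ?thesis using f by blast
  qed
  have "inj_on k C"
  proof (rule inj_onI)
    fix h h' assume hh: "h \<in> C" "h' \<in> C" "k h = k h'"
    then have "p (k h) \<in> h \<inter> h'" using k [of h] k [of h'] by auto
    then show "h = h'" using disj hh by blast
  qed
  then have "card C \<le> card {..n}" using k by (intro card_inj_on_le [of k]) auto
  then show ?thesis by simp
qed

section \<open>The curtain metric recognises distance at most one\<close>

lemma singleton_L_chain:
  assumes "separates h A B"
  shows "is_L_chain L {h}"
proof -
  have "is_curtain h" using assms by (auto simp: separates_def is_curtain_def)
  then have "is_chain {h}"
    unfolding is_chain_def by (intro exI [of _ "{0}"] exI [of _ "\<lambda>_. h"]) auto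
  then show ?thesis by (simp add: is_L_chain_def)
qed

text \<open>A bound on the chains gives meaning to the maximum in \<open>d_L\<close>, which is taken over a finite
  set. That it does not depend on \<open>L\<close> makes the series \<open>D x y\<close> converge.\<close>

lemma CAT0_d_L_bounded:
  fixes x y :: "'a::metric_space"
  assumes cat: "CAT0 TYPE('a)"
  obtains N where "\<And>L C. is_L_chain L C \<Longrightarrow> chain_separates C {x} {y} \<Longrightarrow> card C \<le> N"
    and "\<And>L. d_L L x y \<le> Suc N"
proof -
  obtain \<gamma> where \<gamma>: "geodesic_between \<gamma> x y" by (rule CAT0_ex_geodesic [OF cat])
  obtain n where n: "dist x y \<le> real n" using real_arch_simple by blast
  obtain p where p: "p 0 = x" "p n = y" "\<And>i. dist (p i) (p (Suc i)) \<le> 1"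
    using geodesic_between_unit_steps [OF \<gamma> n] by blast
  have N: "card C \<le> Suc n" if "is_L_chain L C" "chain_separates C {x} {y}" for L C
    using separating_chain_bounded [of p, OF cat p(3), of C n] that p by (simp add: is_L_chain_def)
  have "d_L L x y \<le> Suc (Suc n)" for L
  proof -
    let ?S = "{card C |C. is_L_chain L C \<and> chain_separates C {x} {y}}"
    have "finite ?S" by (rule finite_subset [of _ "{..Suc n}"]) (use N in auto)
    moreover have "is_L_chain L ({} :: 'a set set)"
      unfolding is_L_chain_def is_chain_def by auto
    then have "?S \<noteq> {}" by (auto simp: chain_separates_def intro: exI [of _ "{}"])
    ultimately have "Max ?S \<le> Suc n" using N by auto
    then show ?thesis by (simp add: d_L_def)
  qed
  with N show thesis by (rule that)
qed

lemma CAT0_d_L_near: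
  fixes x y :: "'a::metric_space"
  assumes cat: "CAT0 TYPE('a)" and xy: "dist x y \<le> 1"
  shows "d_L L x y \<le> 1"
proof -
  have "C = {}" if "chain_separates C {x} {y}" for C
    using separates_points_imp_far [OF cat, of _ x y] that xy
    by (fastforce simp: chain_separates_def)
  moreover have "is_L_chain L ({} :: 'a set set)" "chain_separates {} {x} {y}"
    unfolding is_L_chain_def is_chain_def chain_separates_def by auto
  ultimately have "{card C |C. is_L_chain L C \<and> chain_separates C {x} {y}} = {0}"
    by force
  then show ?thesis by (simp add: d_L_def)
qed

lemma CAT0_d_L_far:
  fixes x y :: "'a::metric_space"
  assumes cat: "CAT0 TYPE('a)" and xy: "dist x y > 1"
  shows "d_L L x y \<ge> 2"
proof -
  let ?S = "{card C |C. is_L_chain L C \<and> chain_separates C {x} {y}}"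
  obtain h where h: "separates h {x} {y}" using CAT0_ex_separating_curtain [OF cat xy] by blast
  have "1 = card {h}" "is_L_chain L {h}" "chain_separates {h} {x} {y}"
    using h singleton_L_chain by (auto simp: chain_separates_def)
  then have "1 \<in> ?S" by blast
  moreover obtain N where N: "\<And>C. is_L_chain L C \<Longrightarrow> chain_separates C {x} {y} \<Longrightarrow> card C \<le> N"
    using CAT0_d_L_bounded [OF cat, of x y] by metis
  have "finite ?S" by (rule finite_subset [of _ "{..N}"]) (use N in auto)
  ultimately have "1 \<le> Max ?S" by simp
  then show ?thesis using xy by (auto simp: d_L_def)
qed

lemma curtain_weights_summable:
  assumes "curtain_weights lam"
  shows "summable (\<lambda>n. lam (Suc n))"
proof (rule summable_comparison_test')
  show "summable (\<lambda>n. (real (Suc n))\<^sup>2 * lam (Suc n))"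
    using assms by (simp add: curtain_weights_def)
  show "norm (lam (Suc n)) \<le> (real (Suc n))\<^sup>2 * lam (Suc n)" if "n \<ge> 0" for n
  proof -
    have "0 < lam (Suc n)" using assms by (simp add: curtain_weights_def)
    moreover have "1 \<le> (real (Suc n))\<^sup>2" by (rule one_le_power) simp
    ultimately show ?thesis by simp
  qed
qed

lemma curtain_dist_le_iff:
  fixes x y :: "'a::metric_space"
  assumes cat: "CAT0 TYPE('a)" and lam: "curtain_weights lam"
  shows "curtain_dist lam x y \<le> (\<Sum>n. lam (Suc n)) \<longleftrightarrow> dist x y \<le> 1"
proof -
  have pos: "0 < lam (Suc n)" for n using lam by (simp add: curtain_weights_def)
  note sm = curtain_weights_summable [OF lam]
  obtain N where N: "\<And>L. d_L L x y \<le> Suc N" using CAT0_d_L_bounded [OF cat, of x y] by metis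
  have sd: "summable (\<lambda>n. lam (Suc n) * real (d_L (Suc n) x y))"
  proof (rule summable_comparison_test')
    show "summable (\<lambda>n. lam (Suc n) * real (Suc N))" using sm by (rule summable_mult2)
    show "norm (lam (Suc n) * real (d_L (Suc n) x y)) \<le> lam (Suc n) * real (Suc N)"
      if "n \<ge> 0" for n
      using N [of "Suc n"] pos [of n] by (simp add: abs_mult mult_left_mono del: of_nat_Suc)
  qed
  show ?thesis
  proof (cases "dist x y \<le> 1")
    case True
    have "lam (Suc n) * real (d_L (Suc n) x y) \<le> lam (Suc n)" for n
      using CAT0_d_L_near [OF cat True, of "Suc n"] pos [of n] by (simp add: mult_left_le)
    then have "curtain_dist lam x y \<le> (\<Sum>n. lam (Suc n))"
      unfolding curtain_dist_def by (intro suminf_le sd sm)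
    with True show ?thesis by simp
  next
    case False
    have "lam (Suc n) * 2 \<le> lam (Suc n) * real (d_L (Suc n) x y)" for n
      using CAT0_d_L_far [OF cat, of x y "Suc n"] False pos [of n] by (intro mult_left_mono) auto
    then have "(\<Sum>n. lam (Suc n) * 2) \<le> curtain_dist lam x y"
      unfolding curtain_dist_def by (intro suminf_le sd summable_mult2 sm)
    moreover have "(\<Sum>n. lam (Suc n) * 2) = (\<Sum>n. lam (Suc n)) * 2"
      using sm by (rule suminf_mult2 [symmetric])
    moreover have "0 < (\<Sum>n. lam (Suc n))" using sm pos by (rule suminf_pos)
    ultimately show ?thesis using False by simp
  qed
qed

section \<open>Maps preserving distance at most one\<close>

lemma dist_le_number_of_steps:
  assumes "\<And>i. dist (p i) (p (Suc i)) \<le> 1"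
  shows "dist (p 0) (p n) \<le> real n"
proof (induction n)
  case (Suc n)
  have "dist (p 0) (p (Suc n)) \<le> dist (p 0) (p n) + dist (p n) (p (Suc n))"
    by (rule dist_triangle)
  then show ?case using Suc assms [of n] by simp
qed simp

lemma unit_step_map_dist_le:
  fixes f :: "'a::metric_space \<Rightarrow> 'b::metric_space"
  assumes geo: "\<exists>\<gamma>. geodesic_between \<gamma> x y"
    and f: "\<And>x y. dist x y \<le> 1 \<Longrightarrow> dist (f x) (f y) \<le> 1"
  shows "dist (f x) (f y) \<le> dist x y + 1"
proof -
  \<comment> \<open>Rounding up to a whole number of steps is the source of the additive error \<open>1\<close>.\<close>
  define n where "n = nat \<lceil>dist x y\<rceil>"
  have n: "dist x y \<le> real n" "real n \<le> dist x y + 1"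
    using ceiling_correct [of "dist x y"] by (auto simp: n_def)
  obtain p where p: "p 0 = x" "p n = y" "\<And>i. dist (p i) (p (Suc i)) \<le> 1"
    using geo geodesic_between_unit_steps [OF _ n(1)] by metis
  have "dist (f (p 0)) (f (p n)) \<le> real n"
    using dist_le_number_of_steps [of "f \<circ> p"] f p(3) by simp
  then show ?thesis using p n by simp
qed

theorem theorem10:
  fixes lam :: "nat \<Rightarrow> real" and g :: "'a::metric_space \<Rightarrow> 'a"
  assumes "CAT0 TYPE('a)"
    and "curtain_weights lam"
    and "curtain_model_isometry lam g"
  shows "quasiisometry_1_1 g"
proof -
  have g: "bij g" and iso: "\<And>x y. curtain_dist lam (g x) (g y) = curtain_dist lam x y"
    using assms(3) by (auto simp: curtain_model_isometry_def)
  have geo: "\<exists>\<gamma>. geodesic_between \<gamma> x y" for x y :: 'a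
    using CAT0_ex_geodesic [OF assms(1)] by metis
  have unit: "dist (g x) (g y) \<le> 1 \<longleftrightarrow> dist x y \<le> 1" for x y
    using iso by (simp flip: curtain_dist_le_iff [OF assms(1,2)])
  have inv: "g (inv g x) = x" "inv g (g x) = x" for x
    using g by (simp_all add: bij_is_surj surj_f_inv_f bij_is_inj)
  have "dist (g x) (g y) \<le> dist x y + 1" for x y
    by (rule unit_step_map_dist_le [OF geo]) (simp add: unit)
  moreover have "dist x y \<le> dist (g x) (g y) + 1" for x y
  proof -
    have "dist (inv g (g x)) (inv g (g y)) \<le> dist (g x) (g y) + 1"
      by (rule unit_step_map_dist_le [OF geo]) (metis inv(1) unit)
    then show ?thesis by (simp add: inv)
  qed
  ultimately have "\<bar>dist (g x) (g y) - dist x y\<bar> \<le> 1" for x y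
    by (simp add: abs_le_iff algebra_simps)
  moreover have "\<exists>x. dist (g x) y \<le> 0" for y using inv by (metis dist_self order_refl)
  ultimately show ?thesis
    unfolding quasiisometry_1_1_def coarsely_surjective_def by blast
qed

end
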